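(* Let $\Delta\ge3$. For every finite graph $G$ of maximum degree at most $\Delta$, every $\lambda\ge1$ and every $\beta\ge0$, \[\eta_G(\beta,\lambda)\le\eta^+_{\Delta,\beta,\lambda}.\]
   Context: The Ising model on a finite graph $G$ at inverse temperature $\beta$ and activity $\lambda>0$ is the distribution $\mu_{G,\beta,\lambda}(\sigma)\propto e^{\frac{\beta}{2}\sum_{uv\in E(G)}\sigma_u\sigma_v}\lambda^{M(\sigma)}$ on $\sigma\in\{\pm1\}^{V(G)}$, where $M(\sigma)=\sum_v\sigma_v$. The mean magnetization is $\eta_G(\beta,\lambda)=\mathbb{E}_{\mu_{G,\beta,\lambda}}[M(\sigma)]/|V(G)|$. The quantity $\eta^+_{\Delta,\beta,\lambda}$ is the magnetization of the $+$ measure on the infinite $\Delta$-regular tree: $\eta^+_{\Delta,\beta,\lambda}=\tanh\big(L^*+\operatorname{artanh}(\tanh L^*\tanh\tfrac{\beta}{2})\big)$, where $L^*$ is the largest solution of $L^*=\log\lambda+(\Delta-1)\operatorname{artanh}(\tanh L^*\tanh\tfrac{\beta}{2})$. *)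

theory Defs
  imports "HOL-Analysis.Analysis" "HOL-Library.FuncSet"
begin

definition simple_graph :: "'a set \<Rightarrow> ('a \<Rightarrow> 'a \<Rightarrow> bool) \<Rightarrow> bool" where
  "simple_graph V E \<longleftrightarrow> finite V \<and> (\<forall>u v. E u v \<longrightarrow> E v u) \<and> (\<forall>u. \<not> E u u)
     \<and> (\<forall>u v. E u v \<longrightarrow> u \<in> V \<and> v \<in> V)"

definition max_degree_le :: "'a set \<Rightarrow> ('a \<Rightarrow> 'a \<Rightarrow> bool) \<Rightarrow> nat \<Rightarrow> bool" where
  "max_degree_le V E D \<longleftrightarrow> (\<forall>u\<in>V. card {v\<in>V. E u v} \<le> D)"

definition configs :: "'a set \<Rightarrow> ('a \<Rightarrow> real) set" where
  "configs V = V \<rightarrow>\<^sub>E {-1, 1}"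

definition edge_sum :: "'a set \<Rightarrow> ('a \<Rightarrow> 'a \<Rightarrow> bool) \<Rightarrow> ('a \<Rightarrow> real) \<Rightarrow> real" where
  "edge_sum V E \<sigma> = (\<Sum>e\<in>{{u, v} | u v. u \<in> V \<and> v \<in> V \<and> E u v}.
                        (\<Prod>w\<in>e. \<sigma> w))"

definition magnetization :: "'a set \<Rightarrow> ('a \<Rightarrow> real) \<Rightarrow> real" where
  "magnetization V \<sigma> = (\<Sum>v\<in>V. \<sigma> v)"

definition ising_weight :: "'a set \<Rightarrow> ('a \<Rightarrow> 'a \<Rightarrow> bool) \<Rightarrow> real \<Rightarrow> real \<Rightarrow> ('a \<Rightarrow> real) \<Rightarrow> real" where
  "ising_weight V E \<beta> lam \<sigma> = exp (\<beta> / 2 * edge_sum V E \<sigma>) * lam powr magnetization V \<sigma>"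

definition mean_mag :: "'a set \<Rightarrow> ('a \<Rightarrow> 'a \<Rightarrow> bool) \<Rightarrow> real \<Rightarrow> real \<Rightarrow> real" where
  "mean_mag V E \<beta> lam =
     ((\<Sum>\<sigma>\<in>configs V. magnetization V \<sigma> * ising_weight V E \<beta> lam \<sigma>)
       / (\<Sum>\<sigma>\<in>configs V. ising_weight V E \<beta> lam \<sigma>)) / real (card V)"

definition tree_Lstar :: "nat \<Rightarrow> real \<Rightarrow> real \<Rightarrow> real" where
  "tree_Lstar D \<beta> lam = (GREATEST L. L = ln lam + (real D - 1) * artanh (tanh L * tanh (\<beta> / 2)))"

definition tree_mag_plus :: "nat \<Rightarrow> real \<Rightarrow> real \<Rightarrow> real" where
  "tree_mag_plus D \<beta> lam =
     (let L = tree_Lstar D \<beta> lam in tanh (L + artanh (tanh L * tanh (\<beta> / 2))))"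

end

theory Submission
  imports Defs
begin

text \<open>
  The effective field at a vertex is encoded by the ratio of the partition functions with that spin
  pinned to + and to -.  With \<open>h, a, b \<ge> 0\<close> fields, the key inequality is
  \<open>Z(h+a+b) Z(h-a) Z(h-b) \<le> Z(h-a-b) Z(h+a) Z(h+b)\<close>, proved with four replicas in the manner of
  Ellis and Monroe: multiply both sides by \<open>Z(h)\<close> and rotate the four replicas orthogonally; the two
  sides then differ only in the sign of three of the four rotated variables, and every single-site
  moment of the rotated variables is nonnegative and keeps its absolute value under this change of
  signs.

  Pinning a vertex shifts the fields at its neighbours, so the key inequality bounds the ratio at a
  vertex by the tree recursion applied to the ratios of its neighbours in the graph with that vertex
  removed, where these neighbours have degree at most \<open>D - 1\<close>.  Induction on the graph bounds the ratios by
  the fixed point \<open>exp (2 L)\<close> of the recursion; no boundary condition is ever created, hence any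
  nonnegative fixed point would do.
\<close>

section \<open>Polynomials with nonnegative coefficients\<close>

text \<open>Building the class from monomials by addition means that an inequality linear in the
  function has to be checked only for monomials, over which sums over configurations factor site by
  site.\<close>

inductive nonneg_poly :: "'i set \<Rightarrow> (('i \<Rightarrow> real) \<Rightarrow> real) \<Rightarrow> bool" for I where
  monomial: "c \<ge> 0 \<Longrightarrow> nonneg_poly I (\<lambda>y. c * (\<Prod>i\<in>I. y i ^ e i))"
| add: "nonneg_poly I f \<Longrightarrow> nonneg_poly I g \<Longrightarrow> nonneg_poly I (\<lambda>y. f y + g y)"

lemma nonneg_poly_const: "c \<ge> 0 \<Longrightarrow> nonneg_poly I (\<lambda>_. c)"
  using nonneg_poly.monomial[of c I "\<lambda>_. 0"] by simp

lemma nonneg_poly_var: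
  assumes "finite I" "j \<in> I"
  shows "nonneg_poly I (\<lambda>y. y j)"
proof -
  have "(\<Prod>i\<in>I. y i ^ (if i = j then 1 else 0)) = y j" for y :: "'a \<Rightarrow> real"
    using assms by (simp add: if_distrib[of "power _"] prod.delta cong: if_cong)
  then show ?thesis
    using nonneg_poly.monomial[of 1 I "\<lambda>i. if i = j then 1 else 0"] by simp
qed

lemma nonneg_poly_mult:
  assumes "nonneg_poly I f" "nonneg_poly I g"
  shows "nonneg_poly I (\<lambda>y. f y * g y)"
  using assms(1)
proof induction
  case (monomial c e)
  show ?case using assms(2)
  proof induction
    case (monomial c' e')
    then show ?case
      using nonneg_poly.monomial[of "c * c'" I "\<lambda>i. e i + e' i"] \<open>c \<ge> 0\<close>
      by (simp add: power_add prod.distrib mult_ac)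
  next
    case (add f g)
    then show ?case using nonneg_poly.add by (fastforce simp: distrib_left)
  qed
next
  case (add f g)
  then show ?case using nonneg_poly.add by (fastforce simp: distrib_right)
qed

lemma nonneg_poly_power: "nonneg_poly I f \<Longrightarrow> nonneg_poly I (\<lambda>y. f y ^ n)"
  by (induction n) (auto intro: nonneg_poly_const nonneg_poly_mult)

lemma nonneg_poly_sum:
  "(\<And>x. x \<in> A \<Longrightarrow> nonneg_poly I (f x)) \<Longrightarrow> nonneg_poly I (\<lambda>y. \<Sum>x\<in>A. f x y)"
  by (induction A rule: infinite_finite_induct) (auto intro: nonneg_poly_const nonneg_poly.add)

section \<open>Rotating four replicas at a single site\<close>

text \<open>The last row is oriented so that the product of the four rotated values of a \<open>\<plusminus>1\<close>
  quadruple is never negative; the opposite sign would break positivity of the odd moments.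
  Only the indices \<open>0, \<dots>, 3\<close> matter.\<close>

fun rotate4 :: "real \<Rightarrow> real \<Rightarrow> real \<Rightarrow> real \<Rightarrow> nat \<Rightarrow> real" where
  "rotate4 a b c d 0 = (a + b + c + d) / 2"
| "rotate4 a b c d (Suc 0) = (a + b - c - d) / 2"
| "rotate4 a b c d (Suc (Suc 0)) = (a - b + c - d) / 2"
| "rotate4 a b c d (Suc (Suc (Suc _))) = (b + c - a - d) / 2"

abbreviation flip4 :: "nat \<Rightarrow> real" where
  "flip4 j \<equiv> (if j = 0 then 1 else - 1)"

text \<open>Orthogonality of the rotation: it preserves the pair interaction, an inner product of
  two spin quadruples, and the field term, an inner product of fields and spins.\<close>

lemma rotate4_inner:
  "(\<Sum>j<4. rotate4 a b c d j * rotate4 a' b' c' d' j) = a * a' + b * b' + c * c' + d * d'"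
  by (simp add: eval_nat_numeral field_simps)

text \<open>Exchanging replicas in pairs and negating all spins only change signs of rotated
  variables, so the moment vanishes unless the four exponents have the same parity. If all are even,
  every term is a product of squares; if all are odd, the factor left over is the product of the
  four rotated values, which is nonnegative.\<close>

lemma single_site_moment_nonneg:
  "(\<Sum>a\<in>{-1,1}. \<Sum>b\<in>{-1,1}. \<Sum>c\<in>{-1,1}. \<Sum>d\<in>{-1,1}. \<Prod>j<4. rotate4 a b c d j ^ e j) \<ge> 0"
  by (cases "even (e 0)"; cases "even (e 1)"; cases "even (e 2)"; cases "even (e 3)")
     (simp_all add: eval_nat_numeral power_0_left)

text \<open>The signs do not depend on the spins and leave the sum as one factor of absolute value
  1.\<close>

lemma single_site_moment_flip:
  "\<bar>\<Sum>a\<in>{-1,1}. \<Sum>b\<in>{-1,1}. \<Sum>c\<in>{-1,1}. \<Sum>d\<in>{-1,1}. \<Prod>j<4. (flip4 j * rotate4 a b c d j) ^ e j\<bar>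
   = (\<Sum>a\<in>{-1,1}. \<Sum>b\<in>{-1,1}. \<Sum>c\<in>{-1,1}. \<Sum>d\<in>{-1,1}. \<Prod>j<4. rotate4 a b c d j ^ e j)"
    (is "\<bar>?L\<bar> = ?R")
proof -
  have "?L = (\<Prod>j<4. flip4 j ^ e j) * ?R"
    by (simp only: power_mult_distrib prod.distrib sum_distrib_left)
  moreover have "\<bar>\<Prod>j<4. flip4 j ^ e j\<bar> = 1"
    unfolding abs_prod by (intro prod.neutral) (simp add: power_abs)
  ultimately show ?thesis
    using single_site_moment_nonneg[of e] by (simp only: abs_mult mult_1 abs_of_nonneg)
qed

abbreviation rotated :: "('a \<Rightarrow> real) \<Rightarrow> ('a \<Rightarrow> real) \<Rightarrow> ('a \<Rightarrow> real) \<Rightarrow> ('a \<Rightarrow> real) \<Rightarrow> 'a \<times> nat \<Rightarrow> real" where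
  "rotated s t u w i \<equiv> rotate4 (s (fst i)) (t (fst i)) (u (fst i)) (w (fst i)) (snd i)"

section \<open>Sums over four replicas\<close>

lemma sum_configs_prod:
  assumes "finite V"
  shows "(\<Sum>\<sigma>\<in>configs V. \<Prod>v\<in>V. f v (\<sigma> v)) = (\<Prod>v\<in>V. \<Sum>a\<in>{-1,1}. f v a :: real)"
  using assms unfolding configs_def by (intro prod_sum_PiE[symmetric]) auto

lemma sum_configs4_prod:
  assumes "finite V"
  shows "(\<Sum>s\<in>configs V. \<Sum>t\<in>configs V. \<Sum>u\<in>configs V. \<Sum>w\<in>configs V.
            \<Prod>v\<in>V. f v (s v) (t v) (u v) (w v))
       = (\<Prod>v\<in>V. \<Sum>a\<in>{-1,1}. \<Sum>b\<in>{-1,1}. \<Sum>c\<in>{-1,1}. \<Sum>d\<in>{-1,1}. f v a b c d :: real)"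
proof -
  note * = sum_configs_prod[OF assms]
  have "(\<Sum>s\<in>configs V. \<Sum>t\<in>configs V. \<Sum>u\<in>configs V. \<Sum>w\<in>configs V.
            \<Prod>v\<in>V. f v (s v) (t v) (u v) (w v))
      = (\<Sum>s\<in>configs V. \<Sum>t\<in>configs V. \<Sum>u\<in>configs V.
            \<Prod>v\<in>V. \<Sum>d\<in>{-1,1}. f v (s v) (t v) (u v) d)"
    by (intro sum.cong refl *)
  also have "\<dots> = (\<Sum>s\<in>configs V. \<Sum>t\<in>configs V.
            \<Prod>v\<in>V. \<Sum>c\<in>{-1,1}. \<Sum>d\<in>{-1,1}. f v (s v) (t v) c d)"
    by (intro sum.cong refl *[of "\<lambda>v c. \<Sum>d\<in>{-1,1}. f v (_ v) (_ v) c d"])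
  also have "\<dots> = (\<Sum>s\<in>configs V.
            \<Prod>v\<in>V. \<Sum>b\<in>{-1,1}. \<Sum>c\<in>{-1,1}. \<Sum>d\<in>{-1,1}. f v (s v) b c d)"
    by (intro sum.cong refl *[of "\<lambda>v b. \<Sum>c\<in>{-1,1}. \<Sum>d\<in>{-1,1}. f v (_ v) b c d"])
  also have "\<dots> = (\<Prod>v\<in>V. \<Sum>a\<in>{-1,1}. \<Sum>b\<in>{-1,1}. \<Sum>c\<in>{-1,1}. \<Sum>d\<in>{-1,1}. f v a b c d)"
    by (rule *[of "\<lambda>v a. \<Sum>b\<in>{-1,1}. \<Sum>c\<in>{-1,1}. \<Sum>d\<in>{-1,1}. f v a b c d"])
  finally show ?thesis .
qed

text \<open>Both sides are linear in \<open>f\<close>, so a monomial suffices. Its sum factors into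
  single-site moments, which are nonnegative without the flip and keep their absolute value under
  it.\<close>

lemma sum_configs4_flip_le:
  assumes "finite V" "nonneg_poly (V \<times> {..<4}) f"
  shows "(\<Sum>s\<in>configs V. \<Sum>t\<in>configs V. \<Sum>u\<in>configs V. \<Sum>w\<in>configs V.
            f (\<lambda>i. flip4 (snd i) * rotated s t u w i))
       \<le> (\<Sum>s\<in>configs V. \<Sum>t\<in>configs V. \<Sum>u\<in>configs V. \<Sum>w\<in>configs V. f (rotated s t u w))"
  using assms(2)
proof induction
  case (monomial c e)
  have *: "(\<Prod>i\<in>V \<times> {..<4}. F (fst i) (snd i) ^ e i) = (\<Prod>v\<in>V. \<Prod>j<4. F v j ^ e (v, j))"
    for F :: "'a \<Rightarrow> nat \<Rightarrow> real"
    by (simp add: prod.cartesian_product case_prod_beta)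
  \<comment> \<open>A factorwise comparison would need nonnegative factors; flipped moments may be
    negative, so absolute values come first.\<close>
  have "(\<Prod>v\<in>V. \<Sum>a\<in>{-1,1}. \<Sum>b\<in>{-1,1}. \<Sum>ca\<in>{-1,1}. \<Sum>d\<in>{-1,1}. \<Prod>j<4. (flip4 j * rotate4 a b ca d j) ^ e (v, j))
    \<le> (\<Prod>v\<in>V. \<bar>\<Sum>a\<in>{-1,1}. \<Sum>b\<in>{-1,1}. \<Sum>ca\<in>{-1,1}. \<Sum>d\<in>{-1,1}. \<Prod>j<4. (flip4 j * rotate4 a b ca d j) ^ e (v, j)\<bar>)"
    unfolding abs_prod[symmetric] by (rule abs_ge_self)
  also have "\<dots> = (\<Prod>v\<in>V. \<Sum>a\<in>{-1,1}. \<Sum>b\<in>{-1,1}. \<Sum>ca\<in>{-1,1}. \<Sum>d\<in>{-1,1}. \<Prod>j<4. (rotate4 a b ca d j) ^ e (v, j))"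
    by (intro prod.cong refl single_site_moment_flip)
  finally have "c * (\<Prod>v\<in>V. \<Sum>a\<in>{-1,1}. \<Sum>b\<in>{-1,1}. \<Sum>ca\<in>{-1,1}. \<Sum>d\<in>{-1,1}. \<Prod>j<4. (flip4 j * rotate4 a b ca d j) ^ e (v, j))
    \<le> c * (\<Prod>v\<in>V. \<Sum>a\<in>{-1,1}. \<Sum>b\<in>{-1,1}. \<Sum>ca\<in>{-1,1}. \<Sum>d\<in>{-1,1}. \<Prod>j<4. (rotate4 a b ca d j) ^ e (v, j))"
    using monomial by (rule mult_left_mono)
  then show ?case
    unfolding sum_configs4_prod[OF assms(1), symmetric]
      *[of "\<lambda>v j. rotate4 (_ v) (_ v) (_ v) (_ v) j"]
      *[of "\<lambda>v j. flip4 j * rotate4 (_ v) (_ v) (_ v) (_ v) j"] sum_distrib_left[symmetric]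
    by simp
next
  case (add f g)
  then show ?case by (simp add: sum.distrib)
qed

text \<open>The exponential series reduces this to powers of \<open>f\<close>, which stay in the
  class; the termwise inequality passes to the limit.\<close>

lemma sum_configs4_exp_flip_le:
  assumes "finite V" "nonneg_poly (V \<times> {..<4}) f"
  shows "(\<Sum>s\<in>configs V. \<Sum>t\<in>configs V. \<Sum>u\<in>configs V. \<Sum>w\<in>configs V.
            exp (f (\<lambda>i. flip4 (snd i) * rotated s t u w i)))
       \<le> (\<Sum>s\<in>configs V. \<Sum>t\<in>configs V. \<Sum>u\<in>configs V. \<Sum>w\<in>configs V. exp (f (rotated s t u w)))"
proof (rule sums_le)
  show "(\<lambda>n. \<Sum>s\<in>configs V. \<Sum>t\<in>configs V. \<Sum>u\<in>configs V. \<Sum>w\<in>configs V.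
            inverse (fact n) * f (\<lambda>i. flip4 (snd i) * rotated s t u w i) ^ n)
    sums (\<Sum>s\<in>configs V. \<Sum>t\<in>configs V. \<Sum>u\<in>configs V. \<Sum>w\<in>configs V.
            exp (f (\<lambda>i. flip4 (snd i) * rotated s t u w i)))"
    using exp_converges[where 'a = real] by (intro sums_sum) simp
  show "(\<lambda>n. \<Sum>s\<in>configs V. \<Sum>t\<in>configs V. \<Sum>u\<in>configs V. \<Sum>w\<in>configs V.
            inverse (fact n) * f (rotated s t u w) ^ n)
    sums (\<Sum>s\<in>configs V. \<Sum>t\<in>configs V. \<Sum>u\<in>configs V. \<Sum>w\<in>configs V. exp (f (rotated s t u w)))"
    using exp_converges[where 'a = real] by (intro sums_sum) simp
  show "(\<Sum>s\<in>configs V. \<Sum>t\<in>configs V. \<Sum>u\<in>configs V. \<Sum>w\<in>configs V.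
            inverse (fact n) * f (\<lambda>i. flip4 (snd i) * rotated s t u w i) ^ n)
    \<le> (\<Sum>s\<in>configs V. \<Sum>t\<in>configs V. \<Sum>u\<in>configs V. \<Sum>w\<in>configs V.
            inverse (fact n) * f (rotated s t u w) ^ n)" for n
    using assms by (intro sum_configs4_flip_le nonneg_poly_mult nonneg_poly_const nonneg_poly_power) simp_all
qed

section \<open>Energies, partition functions and spin ratios\<close>

text \<open>The double sum counts every pair twice, hence the factor 1/2.\<close>

definition energy :: "('a \<Rightarrow> 'a \<Rightarrow> real) \<Rightarrow> 'a set \<Rightarrow> ('a \<Rightarrow> real) \<Rightarrow> ('a \<Rightarrow> real) \<Rightarrow> real" where
  "energy J S h \<sigma> = (\<Sum>u\<in>S. \<Sum>v\<in>S. J u v * \<sigma> u * \<sigma> v) / 2 + (\<Sum>v\<in>S. h v * \<sigma> v)"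

definition partition_function :: "('a \<Rightarrow> 'a \<Rightarrow> real) \<Rightarrow> 'a set \<Rightarrow> ('a \<Rightarrow> real) \<Rightarrow> real" where
  "partition_function J S h = (\<Sum>\<sigma>\<in>configs S. exp (energy J S h \<sigma>))"

definition pinned_part :: "('a \<Rightarrow> 'a \<Rightarrow> real) \<Rightarrow> 'a set \<Rightarrow> ('a \<Rightarrow> real) \<Rightarrow> 'a \<Rightarrow> real \<Rightarrow> real" where
  "pinned_part J S h v a = (\<Sum>\<sigma>\<in>{\<sigma>\<in>configs S. \<sigma> v = a}. exp (energy J S h \<sigma>))"

definition spin_ratio :: "('a \<Rightarrow> 'a \<Rightarrow> real) \<Rightarrow> 'a set \<Rightarrow> ('a \<Rightarrow> real) \<Rightarrow> 'a \<Rightarrow> real" where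
  "spin_ratio J S h v = pinned_part J S h v 1 / pinned_part J S h v (- 1)"

lemma finite_configs: "finite S \<Longrightarrow> finite (configs S)"
  unfolding configs_def by (rule finite_PiE) auto

lemma configs_nonempty: "configs S \<noteq> {}"
  unfolding configs_def by (simp add: PiE_eq_empty_iff)

lemma partition_function_pos: "finite S \<Longrightarrow> partition_function J S h > 0"
  unfolding partition_function_def by (intro sum_pos finite_configs configs_nonempty) auto

lemma configs_insert_pinned:
  assumes "v \<notin> S" "a \<in> {-1, 1}"
  shows "bij_betw (\<lambda>\<sigma>. \<sigma>(v := a)) (configs S) {\<sigma> \<in> configs (insert v S). \<sigma> v = a}"
proof (rule bij_betw_imageI)
  \<comment> \<open>Configurations are extensional: at \<open>v\<close>, outside \<open>S\<close>,
    the value is \<open>undefined\<close>, so the update loses no information.\<close>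
  have *: "\<sigma> v = undefined" if "\<sigma> \<in> configs S" for \<sigma>
    using that assms unfolding configs_def by (auto simp: PiE_def extensional_def)
  show "inj_on (\<lambda>\<sigma>. \<sigma>(v := a)) (configs S)"
    by (rule inj_onI) (metis * fun_upd_triv fun_upd_upd)
  show "(\<lambda>\<sigma>. \<sigma>(v := a)) ` configs S = {\<sigma> \<in> configs (insert v S). \<sigma> v = a}"
    using assms unfolding configs_def PiE_insert_eq by (auto simp: image_iff fun_upd_idem_iff)
qed

section \<open>The edge factor and its \<open>tanh\<close> form\<close>

text \<open>The map \<open>exp (2 L) \<mapsto> exp (2 artanh (tanh L tanh B))\<close>, see \<open>exp_artanh_tanh_mult\<close> below.\<close>

definition edge_factor :: "real \<Rightarrow> real \<Rightarrow> real" where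
  "edge_factor B r = (exp (2 * B) * r + 1) / (r + exp (2 * B))"

lemma edge_factor_zero: "r > 0 \<Longrightarrow> edge_factor 0 r = 1"
  unfolding edge_factor_def by simp

lemma edge_factor_pos: "r > 0 \<Longrightarrow> edge_factor B r > 0"
  unfolding edge_factor_def by (intro divide_pos_pos add_pos_pos mult_pos_pos) auto

lemma edge_factor_ge_one:
  assumes "B \<ge> 0" "r \<ge> 1"
  shows "edge_factor B r \<ge> 1"
proof -
  \<comment> \<open>This product is numerator minus denominator of
    \<open>edge_factor B r\<close>.\<close>
  have "(exp (2 * B) - 1) * (r - 1) \<ge> 0"
    using assms by (intro mult_nonneg_nonneg) auto
  moreover have "r + exp (2 * B) > 0"
    using assms by (intro add_pos_pos) auto
  ultimately show ?thesis
    unfolding edge_factor_def by (simp add: le_divide_eq algebra_simps)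
qed

lemma edge_factor_mono:
  assumes "B \<ge> 0" "0 < r" "r \<le> s"
  shows "edge_factor B r \<le> edge_factor B s"
proof -
  define q where "q = exp (2 * B)"
  have q: "q \<ge> 1" using assms unfolding q_def by simp
  \<comment> \<open>This is the difference of the two cross products compared next.\<close>
  have "(q * q - 1) * (s - r) \<ge> 0"
    using assms q mult_mono[of 1 q 1 q] by (intro mult_nonneg_nonneg) auto
  then have "(q * r + 1) * (s + q) \<le> (q * s + 1) * (r + q)"
    by (simp add: algebra_simps)
  moreover have "r + q > 0" "s + q > 0" using assms q by auto
  ultimately show ?thesis
    unfolding edge_factor_def q_def[symmetric] by (simp add: divide_le_eq le_divide_eq field_simps)
qed

lemma tanh_eq_exp: "tanh (x :: real) = (exp (2 * x) - 1) / (exp (2 * x) + 1)"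
proof -
  have "(1 - 1 / r) / (1 + 1 / r) = (r - 1) / (r + 1)" if "r > 0" for r :: real
  proof -
    have "1 + 1 / r > 0" "r + 1 > 0" using that by (auto intro: add_pos_pos)
    then show ?thesis using that by (subst frac_eq_eq) (auto simp: field_simps)
  qed
  from this[of "exp (2 * x)"] show ?thesis
    unfolding tanh_real_altdef by (simp add: exp_minus inverse_eq_divide)
qed

lemma abs_tanh_mult_tanh_less_one: "\<bar>tanh x * tanh (y :: real)\<bar> < 1"
proof -
  have "\<bar>tanh x\<bar> < 1" "\<bar>tanh y\<bar> < 1"
    using tanh_real_bounds[of x] tanh_real_bounds[of y] by (auto simp: abs_less_iff)
  then have "\<bar>tanh x\<bar> * \<bar>tanh y\<bar> < 1 * 1"
    by (intro mult_strict_mono') auto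
  then show ?thesis by (simp add: abs_mult)
qed

lemma exp_artanh_tanh_mult:
  "exp (2 * artanh (tanh L * tanh B)) = edge_factor B (exp (2 * L))"
proof -
  define x where "x = tanh L * tanh B"
  define r q where "r = exp (2 * L)" and "q = exp (2 * B)"
  have pos: "r > 0" "q > 0" unfolding r_def q_def by simp_all
  have x: "\<bar>x\<bar> < 1" unfolding x_def by (rule abs_tanh_mult_tanh_less_one)
  \<comment> \<open>\<open>artanh x\<close> is half the logarithm of this quotient, which is
    positive because the absolute value of \<open>x\<close> is below 1.\<close>
  then have "exp (2 * artanh x) = (1 + x) / (1 - x)"
    unfolding artanh_def by simp
  also have "\<dots> = ((r + 1) * (q + 1) + (r - 1) * (q - 1)) / ((r + 1) * (q + 1) - (r - 1) * (q - 1))"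
  proof -
    have "(r + 1) * (q + 1) > 0" using pos by (intro mult_pos_pos) auto
    moreover have "(1 + b / a) / (1 - b / a) = (a + b) / (a - b)" if "a > 0" for a b :: real
    proof -
      have "(1 + b / a) / (1 - b / a) = ((1 + b / a) * a) / ((1 - b / a) * a)"
        using that by simp
      then show ?thesis using that by (simp add: algebra_simps)
    qed
    moreover have "x = ((r - 1) * (q - 1)) / ((r + 1) * (q + 1))"
      unfolding x_def tanh_eq_exp r_def q_def by simp
    ultimately show ?thesis by simp
  qed
  also have "\<dots> = (2 * (q * r + 1)) / (2 * (r + q))"
    by (simp add: algebra_simps)
  also have "\<dots> = edge_factor B r"
    unfolding edge_factor_def q_def[symmetric] by (rule mult_divide_mult_cancel_left) simp
  finally show ?thesis unfolding x_def r_def .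
qed

section \<open>Pinning spins and shifting fields in a ferromagnet\<close>

text \<open>The couplings live on the whole type and the vertex set is an argument of each lemma, so
  deleting a vertex only shrinks \<open>S\<close>.\<close>

locale ferromagnet =
  fixes J :: "'a \<Rightarrow> 'a \<Rightarrow> real"
  assumes J_sym: "J u v = J v u" and J_irrefl: "J v v = 0" and J_nonneg: "J u v \<ge> 0"
begin

text \<open>Pairs containing \<open>v\<close> are counted twice by symmetry, which cancels the 1/2
  in \<open>energy\<close>; once the spin at \<open>v\<close> is fixed they act as fields on the
  remaining vertices.\<close>

lemma energy_insert:
  assumes "finite S" "v \<notin> S"
  shows "energy J (insert v S) h (\<sigma>(v := a)) = a * h v + energy J S (\<lambda>u. h u + a * J v u) \<sigma>"
proof -
  have 1: "(\<Sum>u\<in>insert v S. \<Sum>w\<in>insert v S. J u w * (\<sigma>(v := a)) u * (\<sigma>(v := a)) w)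
    = 2 * (\<Sum>w\<in>S. J v w * a * \<sigma> w) + (\<Sum>u\<in>S. \<Sum>w\<in>S. J u w * \<sigma> u * \<sigma> w)"
  proof -
    have "(\<Sum>u\<in>S. \<Sum>w\<in>insert v S. J u w * (\<sigma>(v := a)) u * (\<sigma>(v := a)) w)
        = (\<Sum>u\<in>S. J v u * a * \<sigma> u + (\<Sum>w\<in>S. J u w * \<sigma> u * \<sigma> w))"
    proof (intro sum.cong refl)
      fix u assume "u \<in> S"
      then have "(\<Sum>w\<in>S. J u w * (\<sigma>(v := a)) u * (\<sigma>(v := a)) w) = (\<Sum>w\<in>S. J u w * \<sigma> u * \<sigma> w)"
        using assms by (intro sum.cong) auto
      then show "(\<Sum>w\<in>insert v S. J u w * (\<sigma>(v := a)) u * (\<sigma>(v := a)) w)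
          = J v u * a * \<sigma> u + (\<Sum>w\<in>S. J u w * \<sigma> u * \<sigma> w)"
        using assms \<open>u \<in> S\<close> J_sym[of u v] by (auto simp: mult_ac)
    qed
    moreover have "(\<Sum>w\<in>insert v S. J v w * (\<sigma>(v := a)) v * (\<sigma>(v := a)) w) = (\<Sum>w\<in>S. J v w * a * \<sigma> w)"
      using assms by (auto simp: J_irrefl intro!: sum.cong)
    ultimately show ?thesis
      using assms(1) by (simp only: sum.insert[OF assms] sum.distrib)
  qed
  have 2: "(\<Sum>w\<in>insert v S. h w * (\<sigma>(v := a)) w) = a * h v + (\<Sum>w\<in>S. h w * \<sigma> w)"
    using assms by (auto intro!: sum.cong)
  show ?thesis
    unfolding energy_def 1 2 by (simp add: sum.distrib distrib_left mult_ac)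
qed

lemma pinned_part_insert:
  assumes "finite S" "v \<notin> S" "a \<in> {-1, 1}"
  shows "pinned_part J (insert v S) h v a = exp (a * h v) * partition_function J S (\<lambda>u. h u + a * J v u)"
  unfolding pinned_part_def partition_function_def sum_distrib_left
    sum.reindex_bij_betw[OF configs_insert_pinned[OF assms(2,3)], symmetric]
  by (simp add: energy_insert assms exp_add)

lemma pinned_part_pos:
  assumes "finite S" "v \<in> S" "a \<in> {-1, 1}"
  shows "pinned_part J S h v a > 0"
  using pinned_part_insert[of "S - {v}" v a h] assms partition_function_pos[of "S - {v}"]
  by (simp add: insert_absorb)

lemma sum_configs_split:
  assumes "finite S" "v \<in> S"
  shows "(\<Sum>\<sigma>\<in>configs S. F \<sigma>)
    = (\<Sum>\<sigma>\<in>{\<sigma>\<in>configs S. \<sigma> v = 1}. F \<sigma>) + (\<Sum>\<sigma>\<in>{\<sigma>\<in>configs S. \<sigma> v = - 1}. F \<sigma> :: real)"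
proof -
  have "configs S = {\<sigma>\<in>configs S. \<sigma> v = 1} \<union> {\<sigma>\<in>configs S. \<sigma> v = - 1}"
    using assms(2) unfolding configs_def by (auto dest: PiE_mem)
  moreover have "(\<Sum>\<sigma>\<in>{\<sigma>\<in>configs S. \<sigma> v = 1} \<union> {\<sigma>\<in>configs S. \<sigma> v = - 1}. F \<sigma>)
    = (\<Sum>\<sigma>\<in>{\<sigma>\<in>configs S. \<sigma> v = 1}. F \<sigma>) + (\<Sum>\<sigma>\<in>{\<sigma>\<in>configs S. \<sigma> v = - 1}. F \<sigma>)"
    using finite_configs[OF assms(1)] by (intro sum.union_disjoint) auto
  ultimately show ?thesis by simp
qed

lemma partition_function_shift:
  assumes "finite S" "v \<in> S"
  shows "partition_function J S (h(v := h v + b)) = exp b * pinned_part J S h v 1 + exp (- b) * pinned_part J S h v (- 1)"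
proof -
  have *: "energy J S (h(v := h v + b)) \<sigma> = b * \<sigma> v + energy J S h \<sigma>" for \<sigma>
  proof -
    have "(\<Sum>w\<in>S. (h(v := h v + b)) w * \<sigma> w) = b * \<sigma> v + (\<Sum>w\<in>S. h w * \<sigma> w)"
      using assms by (subst (1 2) sum.remove[OF assms]) (simp add: distrib_right)
    then show ?thesis unfolding energy_def by simp
  qed
  show ?thesis
    unfolding partition_function_def sum_configs_split[OF assms] pinned_part_def * sum_distrib_left
    by (intro arg_cong2[where f = "(+)"] sum.cong refl) (auto simp flip: exp_add)
qed

section \<open>The four-replica inequality for partition functions\<close>

text \<open>The total energy of four replicas in rotated variables, indexed by site and row of the
  rotation. The interaction keeps its form, and \<open>k\<close> holds the rotated fields.\<close>

definition poly_energy :: "'a set \<Rightarrow> (nat \<Rightarrow> 'a \<Rightarrow> real) \<Rightarrow> ('a \<times> nat \<Rightarrow> real) \<Rightarrow> real" where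
  "poly_energy S k y = (\<Sum>j<4. (\<Sum>u\<in>S. \<Sum>v\<in>S. J u v / 2 * y (u, j) * y (v, j)) + (\<Sum>v\<in>S. k j v * y (v, j)))"

lemma nonneg_poly_energy:
  assumes "finite S" "\<And>j v. j < 4 \<Longrightarrow> v \<in> S \<Longrightarrow> k j v \<ge> 0"
  shows "nonneg_poly (S \<times> {..<4}) (poly_energy S k)"
  unfolding poly_energy_def using assms J_nonneg
  by (intro nonneg_poly_sum nonneg_poly.add nonneg_poly_mult nonneg_poly_const nonneg_poly_var) auto

lemma poly_energy_rotated:
  "poly_energy S (\<lambda>j v. rotate4 (h1 v) (h2 v) (h3 v) (h4 v) j) (rotated s t u w)
    = energy J S h1 s + energy J S h2 t + energy J S h3 u + energy J S h4 w"
proof -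
  have 1: "(\<Sum>j<4. \<Sum>x\<in>S. \<Sum>v\<in>S. J x v / 2 * rotated s t u w (x, j) * rotated s t u w (v, j))
    = (\<Sum>x\<in>S. \<Sum>v\<in>S. J x v / 2 * (s x * s v + t x * t v + u x * u v + w x * w v))"
    unfolding rotate4_inner[symmetric] sum_distrib_left
    by (subst sum.swap, intro sum.cong refl, subst sum.swap) (simp add: mult_ac)
  have 2: "(\<Sum>j<4. \<Sum>v\<in>S. rotate4 (h1 v) (h2 v) (h3 v) (h4 v) j * rotated s t u w (v, j))
    = (\<Sum>v\<in>S. h1 v * s v + h2 v * t v + h3 v * u v + h4 v * w v)"
    by (subst sum.swap) (simp only: fst_conv snd_conv rotate4_inner)
  show ?thesis
    unfolding poly_energy_def sum.distrib 1 2 energy_def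
    by (simp add: sum.distrib distrib_left sum_divide_distrib mult_ac)
qed

text \<open>In a quadratic term both variables carry the same sign, which cancels; only the fields
  feel the flip.\<close>

lemma poly_energy_flip:
  "poly_energy S k (\<lambda>i. flip4 (snd i) * y i) = poly_energy S (\<lambda>j v. flip4 j * k j v) y"
  unfolding poly_energy_def by (intro sum.cong refl arg_cong2[where f = "(+)"]) auto

lemma sum_exp_poly_energy:
  "(\<Sum>s\<in>configs S. \<Sum>t\<in>configs S. \<Sum>u\<in>configs S. \<Sum>w\<in>configs S.
      exp (poly_energy S (\<lambda>j v. rotate4 (h1 v) (h2 v) (h3 v) (h4 v) j) (rotated s t u w)))
   = partition_function J S h1 * partition_function J S h2 * partition_function J S h3 * partition_function J S h4"
proof -
  have "(\<Sum>s\<in>configs S. \<Sum>t\<in>configs S. \<Sum>u\<in>configs S. \<Sum>w\<in>configs S.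
      exp (poly_energy S (\<lambda>j v. rotate4 (h1 v) (h2 v) (h3 v) (h4 v) j) (rotated s t u w)))
    = (\<Sum>s\<in>configs S. \<Sum>t\<in>configs S. \<Sum>u\<in>configs S. \<Sum>w\<in>configs S.
      exp (energy J S h1 s + energy J S h2 t + energy J S h3 u + energy J S h4 w))"
    by (intro sum.cong refl arg_cong[of _ _ exp] poly_energy_rotated)
  then show ?thesis
    unfolding partition_function_def exp_add sum_distrib_left[symmetric] sum_distrib_right[symmetric] .
qed

lemma partition_function_four_replica:
  assumes "finite S" "\<And>v. v \<in> S \<Longrightarrow> h v \<ge> 0" "\<And>v. v \<in> S \<Longrightarrow> a v \<ge> 0" "\<And>v. v \<in> S \<Longrightarrow> b v \<ge> 0"
  shows "partition_function J S (\<lambda>v. h v + (a v + b v)) * partition_function J S (\<lambda>v. h v - a v) * partition_function J S (\<lambda>v. h v - b v)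
       \<le> partition_function J S (\<lambda>v. h v - (a v + b v)) * partition_function J S (\<lambda>v. h v + a v) * partition_function J S (\<lambda>v. h v + b v)"
proof -
  \<comment> \<open>The rotated fields are \<open>2 * h v\<close>, \<open>b v\<close>,
    \<open>a v\<close> and \<open>a v + b v\<close>, all nonnegative; negating the last three yields
    the fields of the smaller side. The replica with field \<open>h\<close> occurs on both sides and
    is cancelled at the end.\<close>
  define k where "k = (\<lambda>j v. rotate4 (h v) (h v + b v) (h v + a v) (h v - (a v + b v)) j)"
  have k_nonneg: "k j v \<ge> 0" if "j < 4" "v \<in> S" for j v
  proof -
    have "j = 0 \<or> j = Suc 0 \<or> j = Suc (Suc 0) \<or> j = Suc (Suc (Suc 0))"
      using that(1) by auto
    then show ?thesis
      using assms(2-4)[OF that(2)] unfolding k_def by (elim disjE) simp_all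
  qed
  have flip: "(\<lambda>j v. flip4 j * k j v) = (\<lambda>j v. rotate4 (h v) (h v - b v) (h v - a v) (h v + (a v + b v)) j)"
  proof (intro ext)
    show "flip4 j * k j v = rotate4 (h v) (h v - b v) (h v - a v) (h v + (a v + b v)) j" for j v
      unfolding k_def
    \<comment> \<open>The equality is between functions of every index \<open>j\<close>, and the
      last clause of \<open>rotate4\<close> covers all indices from 3 on.\<close>
    proof (cases "j < 3")
      case True
      then have "j = 0 \<or> j = Suc 0 \<or> j = Suc (Suc 0)" by auto
      then show "flip4 j * rotate4 (h v) (h v + b v) (h v + a v) (h v - (a v + b v)) j
        = rotate4 (h v) (h v - b v) (h v - a v) (h v + (a v + b v)) j"
        by (elim disjE) (simp_all add: field_simps)
    next
      case False
      then obtain m where "j = Suc (Suc (Suc m))"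
        using le_Suc_ex[of 3 j] by (auto simp: numeral_3_eq_3)
      then show "flip4 j * rotate4 (h v) (h v + b v) (h v + a v) (h v - (a v + b v)) j
        = rotate4 (h v) (h v - b v) (h v - a v) (h v + (a v + b v)) j"
        by (simp add: field_simps)
    qed
  qed
  have poly: "nonneg_poly (S \<times> {..<4}) (poly_energy S k)"
    by (rule nonneg_poly_energy[OF assms(1) k_nonneg])
  have "partition_function J S h * partition_function J S (\<lambda>v. h v - b v) * partition_function J S (\<lambda>v. h v - a v) * partition_function J S (\<lambda>v. h v + (a v + b v))
     \<le> partition_function J S h * partition_function J S (\<lambda>v. h v + b v) * partition_function J S (\<lambda>v. h v + a v) * partition_function J S (\<lambda>v. h v - (a v + b v))"
    using sum_configs4_exp_flip_le[OF assms(1) poly]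
    unfolding poly_energy_flip flip unfolding k_def sum_exp_poly_energy .
  then have "partition_function J S h * (partition_function J S (\<lambda>v. h v + (a v + b v)) * partition_function J S (\<lambda>v. h v - a v) * partition_function J S (\<lambda>v. h v - b v))
     \<le> partition_function J S h * (partition_function J S (\<lambda>v. h v - (a v + b v)) * partition_function J S (\<lambda>v. h v + a v) * partition_function J S (\<lambda>v. h v + b v))"
    by (simp only: mult_ac)
  then show ?thesis
    using partition_function_pos[OF assms(1), of J h] by (simp only: mult_le_cancel_left_pos)
qed

section \<open>Bounding spin ratios by the tree recursion\<close>

lemma partition_function_cong:
  assumes "\<And>v. v \<in> S \<Longrightarrow> h v = h' v"
  shows "partition_function J S h = partition_function J S h'"
  unfolding partition_function_def energy_def using assms by (simp cong: sum.cong)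

lemma spin_ratio_pos: "finite S \<Longrightarrow> v \<in> S \<Longrightarrow> spin_ratio J S h v > 0"
  unfolding spin_ratio_def by (intro divide_pos_pos pinned_part_pos) auto

text \<open>A field \<open>b\<close> at \<open>v\<close> weighs the two pinned parts by
  \<open>exp b\<close> and \<open>exp (- b)\<close>, a field \<open>- b\<close> the other way round,
  so the quotient depends on the pinned parts only through their ratio.\<close>

lemma partition_function_shift_ratio:
  assumes "finite S" "v \<in> S"
  shows "partition_function J S (h(v := h v + b)) / partition_function J S (h(v := h v - b))
       = edge_factor b (spin_ratio J S h v)"
proof -
  define P M where "P = pinned_part J S h v 1" and "M = pinned_part J S h v (- 1)"
  have pos: "P > 0" "M > 0" unfolding P_def M_def using assms by (auto intro: pinned_part_pos)
  have e: "exp b = exp (2 * b) * exp (- b)" by (simp flip: exp_add)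
  have "partition_function J S (h(v := h v + b)) / partition_function J S (h(v := h v - b))
     = (exp b * P + exp (- b) * M) / (exp (- b) * P + exp b * M)"
    using partition_function_shift[OF assms, of h b] partition_function_shift[OF assms, of h "- b"]
    unfolding P_def M_def by simp
  also have "\<dots> = (exp (- b) * M * (exp (2 * b) * (P / M) + 1)) / (exp (- b) * M * (P / M + exp (2 * b)))"
    using pos unfolding e by (simp add: distrib_left mult_ac)
  also have "\<dots> = edge_factor b (P / M)"
    unfolding edge_factor_def using pos by (intro mult_divide_mult_cancel_left) simp
  finally show ?thesis unfolding spin_ratio_def P_def M_def .
qed

text \<open>The four-replica inequality makes the left-hand ratio submultiplicative in the shift.
  Shifts are switched on one vertex at a time, and a single-vertex ratio is exactly an edge
  factor.\<close>

lemma partition_function_ratio_le: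
  assumes "finite S" "\<And>v. v \<in> S \<Longrightarrow> h v \<ge> 0" "\<And>v. v \<in> S \<Longrightarrow> b v \<ge> 0" "N \<subseteq> S"
  shows "partition_function J S (\<lambda>v. h v + (if v \<in> N then b v else 0))
         / partition_function J S (\<lambda>v. h v - (if v \<in> N then b v else 0))
       \<le> (\<Prod>u\<in>N. edge_factor (b u) (spin_ratio J S h u))"
proof -
  have "finite N" using assms(1,4) by (rule rev_finite_subset)
  then show ?thesis using assms(4)
  proof (induction N)
    case empty
    then show ?case using partition_function_pos[OF assms(1), of J h] by simp
  next
    case (insert u N)
    let ?Z = "partition_function J S"
    \<comment> \<open>\<open>a\<close> carries the shifts already treated, \<open>c\<close> the
      shift at the new vertex \<open>u\<close>.\<close>
    define a where "a = (\<lambda>v. if v \<in> N then b v else 0)"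
    define c where "c = (\<lambda>v. if v = u then b v else 0)"
    have pos: "?Z k > 0" for k using assms(1) by (rule partition_function_pos)
    have sum: "a v + c v = (if v \<in> insert u N then b v else 0)" for v
      unfolding a_def c_def using insert.hyps by auto
    have upd: "(\<lambda>v. h v + c v) = h(u := h u + b u)" "(\<lambda>v. h v - c v) = h(u := h u - b u)"
      unfolding c_def by auto
    have "?Z (\<lambda>v. h v + (a v + c v)) * ?Z (\<lambda>v. h v - a v) * ?Z (\<lambda>v. h v - c v)
      \<le> ?Z (\<lambda>v. h v - (a v + c v)) * ?Z (\<lambda>v. h v + a v) * ?Z (\<lambda>v. h v + c v)"
      using assms by (intro partition_function_four_replica) (auto simp: a_def c_def)
    then have "?Z (\<lambda>v. h v + (a v + c v)) / ?Z (\<lambda>v. h v - (a v + c v))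
      \<le> (?Z (\<lambda>v. h v + a v) / ?Z (\<lambda>v. h v - a v)) * (?Z (\<lambda>v. h v + c v) / ?Z (\<lambda>v. h v - c v))"
      using pos by (simp add: divide_le_eq le_divide_eq mult_ac)
    also have "\<dots> \<le> (\<Prod>u\<in>N. edge_factor (b u) (spin_ratio J S h u)) * edge_factor (b u) (spin_ratio J S h u)"
      unfolding upd using insert assms(1)
      by (intro mult_mono)
         (auto simp: a_def partition_function_shift_ratio intro!: prod_pos less_imp_le edge_factor_pos spin_ratio_pos)
    finally show ?case
      using insert.hyps unfolding sum by (simp add: mult.commute)
  qed
qed

text \<open>Pinning \<open>v\<close> to + or - adds or subtracts the field \<open>J v u\<close> at
  every other vertex \<open>u\<close>, which turns the spin ratio into a ratio of partition
  functions without \<open>v\<close>. Non-neighbours contribute the factor 1 by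
  \<open>edge_factor_zero\<close>.\<close>

lemma spin_ratio_le:
  assumes "finite S" "v \<in> S" "\<And>v. v \<in> S \<Longrightarrow> h v \<ge> 0"
  shows "spin_ratio J S h v
    \<le> exp (2 * h v) * (\<Prod>u\<in>S - {v}. edge_factor (J v u) (spin_ratio J (S - {v}) h u))"
proof -
  let ?T = "S - {v}"
  have T: "finite ?T" "v \<notin> ?T" "insert v ?T = S" using assms by auto
  have "spin_ratio J S h v = (exp (h v) * partition_function J ?T (\<lambda>u. h u + J v u))
      / (exp (- h v) * partition_function J ?T (\<lambda>u. h u - J v u))"
    using pinned_part_insert[OF T(1,2), of 1 h] pinned_part_insert[OF T(1,2), of "- 1" h]
    unfolding spin_ratio_def T(3) by simp
  also have "\<dots> = exp (2 * h v) * (partition_function J ?T (\<lambda>u. h u + J v u)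
      / partition_function J ?T (\<lambda>u. h u - J v u))"
  proof -
    have "exp (h v) = exp (2 * h v) * exp (- h v)" by (simp flip: exp_add)
    then show ?thesis by simp
  qed
  \<comment> \<open>On \<open>?T\<close> the conditional is always true; it gives the form of
    \<open>partition_function_ratio_le\<close> with all of \<open>?T\<close> as
    \<open>N\<close>.\<close>
  also have "partition_function J ?T (\<lambda>u. h u + J v u)
      = partition_function J ?T (\<lambda>u. h u + (if u \<in> ?T then J v u else 0))"
    by (rule partition_function_cong) simp
  also have "partition_function J ?T (\<lambda>u. h u - J v u)
      = partition_function J ?T (\<lambda>u. h u - (if u \<in> ?T then J v u else 0))"
    by (rule partition_function_cong) simp
  also have "exp (2 * h v) * (partition_function J ?T (\<lambda>u. h u + (if u \<in> ?T then J v u else 0))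
      / partition_function J ?T (\<lambda>u. h u - (if u \<in> ?T then J v u else 0)))
    \<le> exp (2 * h v) * (\<Prod>u\<in>?T. edge_factor (J v u) (spin_ratio J ?T h u))"
    using T(1) assms J_nonneg by (intro mult_left_mono partition_function_ratio_le) auto
  finally show ?thesis .
qed

text \<open>Monotonicity of \<open>edge_factor\<close> replaces each neighbour's ratio by
  \<open>R\<close>. Since \<open>R \<ge> 1\<close> makes the edge factor at least 1, having fewer
  than \<open>d\<close> neighbours only helps.\<close>

lemma spin_ratio_step:
  assumes "finite S" "v \<in> S" "l \<ge> 0" "B \<ge> 0" "R \<ge> 1"
    and J: "\<And>u. J v u \<in> {0, B}"
    and deg: "card {u \<in> S. J v u \<noteq> 0} \<le> d"
    and nbr: "\<And>u. u \<in> S - {v} \<Longrightarrow> J v u \<noteq> 0 \<Longrightarrow> spin_ratio J (S - {v}) (\<lambda>_. l) u \<le> R"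
  shows "spin_ratio J S (\<lambda>_. l) v \<le> exp (2 * l) * edge_factor B R ^ d"
proof -
  let ?T = "S - {v}"
  have "(\<Prod>u\<in>?T. edge_factor (J v u) (spin_ratio J ?T (\<lambda>_. l) u))
      \<le> (\<Prod>u\<in>?T. if J v u \<noteq> 0 then edge_factor B R else 1)"
  proof (intro prod_mono conjI)
    fix u assume u: "u \<in> ?T"
    have pos: "spin_ratio J ?T (\<lambda>_. l) u > 0"
      using assms(1) u by (intro spin_ratio_pos) auto
    then show "0 \<le> edge_factor (J v u) (spin_ratio J ?T (\<lambda>_. l) u)"
      by (intro less_imp_le edge_factor_pos)
    show "edge_factor (J v u) (spin_ratio J ?T (\<lambda>_. l) u) \<le> (if J v u \<noteq> 0 then edge_factor B R else 1)"
      using J[of u] pos nbr[OF u] assms(4) by (auto simp: edge_factor_zero intro: edge_factor_mono)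
  qed
  also have "\<dots> = edge_factor B R ^ card {u \<in> ?T. J v u \<noteq> 0}"
    using assms(1) by (simp add: prod.If_cases Int_def)
  also have "{u \<in> ?T. J v u \<noteq> 0} = {u \<in> S. J v u \<noteq> 0}"
    using J_irrefl by auto
  also have "edge_factor B R ^ card \<dots> \<le> edge_factor B R ^ d"
    using deg edge_factor_ge_one[OF assms(4,5)] by (intro power_increasing)
  finally have "exp (2 * l) * (\<Prod>u\<in>?T. edge_factor (J v u) (spin_ratio J ?T (\<lambda>_. l) u))
    \<le> exp (2 * l) * edge_factor B R ^ d"
    by simp
  moreover have "spin_ratio J S (\<lambda>_. l) v
      \<le> exp (2 * l) * (\<Prod>u\<in>?T. edge_factor (J v u) (spin_ratio J ?T (\<lambda>_. l) u))"
    using assms(3) by (intro spin_ratio_le[OF assms(1,2)])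
  ultimately show ?thesis by linarith
qed

lemma card_neighbours_remove:
  assumes "v \<in> S" "J v u \<noteq> 0"
  shows "card {w \<in> S - {v}. J u w \<noteq> 0} = card {w \<in> S. J u w \<noteq> 0} - 1"
proof -
  have "{w \<in> S - {v}. J u w \<noteq> 0} = {w \<in> S. J u w \<noteq> 0} - {v}" by auto
  moreover have "v \<in> {w \<in> S. J u w \<noteq> 0}"
    using assms J_sym[of u v] by simp
  ultimately show ?thesis by simp
qed

text \<open>Induction on the vertex set. Deleting \<open>v\<close> lowers the degree of each of its
  neighbours, so they satisfy the stricter bound \<open>D - 1\<close> in the smaller graph, while
  the other vertices keep the bound \<open>D\<close>.\<close>

lemma spin_ratio_le_fixpoint:
  assumes "finite S" "l \<ge> 0" "B \<ge> 0" "R \<ge> 1"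
    and J: "\<And>u v. J v u \<in> {0, B}"
    and R: "exp (2 * l) * edge_factor B R ^ (D - 1) \<le> R"
    and deg: "\<And>v. v \<in> S \<Longrightarrow> card {u \<in> S. J v u \<noteq> 0} \<le> D"
    and v: "v \<in> S" "card {u \<in> S. J v u \<noteq> 0} \<le> D - 1"
  shows "spin_ratio J S (\<lambda>_. l) v \<le> R"
  using assms(1) deg v
proof (induction S arbitrary: v rule: finite_psubset_induct)
  case (psubset S)
  have "spin_ratio J S (\<lambda>_. l) v \<le> exp (2 * l) * edge_factor B R ^ (D - 1)"
  proof (rule spin_ratio_step)
    fix u assume u: "u \<in> S - {v}" "J v u \<noteq> 0"
    show "spin_ratio J (S - {v}) (\<lambda>_. l) u \<le> R"
    proof (rule psubset.IH)
      show "S - {v} \<subset> S" using psubset.prems by auto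
      show "u \<in> S - {v}" by fact
      have "card {w \<in> S - {v}. J x w \<noteq> 0} \<le> card {w \<in> S. J x w \<noteq> 0}" for x
        using psubset.hyps by (intro card_mono) auto
      then show "card {w \<in> S - {v}. J x w \<noteq> 0} \<le> D" if "x \<in> S - {v}" for x
        using psubset.prems(1)[of x] that order_trans by blast
      show "card {w \<in> S - {v}. J u w \<noteq> 0} \<le> D - 1"
        unfolding card_neighbours_remove[OF psubset.prems(2) u(2)]
        using psubset.prems(1)[of u] u by auto
    qed
  qed (use psubset assms in auto)
  then show ?case using R by linarith
qed

text \<open>A vertex may have \<open>D\<close> neighbours, like the root of the regular tree: one
  more than in the recursion, hence the extra edge factor. With that vertex deleted, its neighbours
  fall under \<open>spin_ratio_le_fixpoint\<close>.\<close>

lemma spin_ratio_le_tree: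
  assumes "finite S" "l \<ge> 0" "B \<ge> 0" "R \<ge> 1" "D \<ge> 1"
    and J: "\<And>u v. J v u \<in> {0, B}"
    and R: "exp (2 * l) * edge_factor B R ^ (D - 1) = R"
    and deg: "\<And>v. v \<in> S \<Longrightarrow> card {u \<in> S. J v u \<noteq> 0} \<le> D"
    and v: "v \<in> S"
  shows "spin_ratio J S (\<lambda>_. l) v \<le> R * edge_factor B R"
proof -
  have "spin_ratio J S (\<lambda>_. l) v \<le> exp (2 * l) * edge_factor B R ^ D"
  proof (rule spin_ratio_step)
    fix u assume u: "u \<in> S - {v}" "J v u \<noteq> 0"
    show "spin_ratio J (S - {v}) (\<lambda>_. l) u \<le> R"
    proof (rule spin_ratio_le_fixpoint[where B = B and D = D])
      have "card {w \<in> S - {v}. J x w \<noteq> 0} \<le> card {w \<in> S. J x w \<noteq> 0}" for x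
        using assms(1) by (intro card_mono) auto
      then show "card {w \<in> S - {v}. J x w \<noteq> 0} \<le> D" if "x \<in> S - {v}" for x
        using deg[of x] that order_trans by blast
      show "card {w \<in> S - {v}. J u w \<noteq> 0} \<le> D - 1"
        unfolding card_neighbours_remove[OF v u(2)] using deg[of u] u by auto
    qed (use assms u in auto)
  qed (use assms in auto)
  also have "\<dots> = (exp (2 * l) * edge_factor B R ^ (D - 1)) * edge_factor B R"
    using assms(5) by (cases D) auto
  finally show ?thesis unfolding R .
qed

text \<open>The mean spin is \<open>(P - M) / (P + M)\<close>, which increases with
  \<open>P / M\<close> and equals \<open>tanh x\<close> when this ratio is
  \<open>exp (2 * x)\<close>.\<close>

lemma sum_spin_le:
  assumes "finite S" "v \<in> S" "spin_ratio J S h v \<le> exp (2 * x)"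
  shows "(\<Sum>\<sigma>\<in>configs S. \<sigma> v * exp (energy J S h \<sigma>)) \<le> tanh x * partition_function J S h"
proof -
  define P M where "P = pinned_part J S h v 1" and "M = pinned_part J S h v (- 1)"
  have pos: "M > 0" unfolding M_def using assms by (auto intro: pinned_part_pos)
  have "P \<le> exp (2 * x) * M"
    using assms(3) pos unfolding spin_ratio_def P_def M_def by (simp add: divide_le_eq)
  then have "(P - M) * (exp (2 * x) + 1) \<le> (exp (2 * x) - 1) * (P + M)"
    by (simp add: algebra_simps)
  then have "P - M \<le> tanh x * (P + M)"
    unfolding tanh_eq_exp by (simp add: le_divide_eq add_pos_pos)
  moreover have "(\<Sum>\<sigma>\<in>configs S. \<sigma> v * exp (energy J S h \<sigma>)) = P - M"
    unfolding sum_configs_split[OF assms(1,2)] P_def M_def pinned_part_def by (simp add: sum_negf)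
  moreover have "partition_function J S h = P + M"
    unfolding partition_function_def sum_configs_split[OF assms(1,2)] P_def M_def pinned_part_def ..
  ultimately show ?thesis by simp
qed

end

section \<open>The Ising weight as a ferromagnet\<close>

lemma edge_sum_eq_double_sum:
  assumes "simple_graph V E"
  shows "edge_sum V E \<sigma> = (\<Sum>u\<in>V. \<Sum>v\<in>V. if E u v then \<sigma> u * \<sigma> v else 0) / 2"
proof -
  have fin: "finite V" and sym: "E u v \<Longrightarrow> E v u" and irr: "\<not> E u u" for u v
    using assms unfolding simple_graph_def by auto
  define P where "P = {p \<in> V \<times> V. E (fst p) (snd p)}"
  have finP: "finite P" unfolding P_def using fin by simp
  have img: "(\<lambda>p. {fst p, snd p}) ` P = {{u, v} | u v. u \<in> V \<and> v \<in> V \<and> E u v}"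
    unfolding P_def by (auto simp: image_iff; blast)
  have "(\<Sum>u\<in>V. \<Sum>v\<in>V. if E u v then \<sigma> u * \<sigma> v else 0) = (\<Sum>p\<in>P. \<sigma> (fst p) * \<sigma> (snd p))"
    unfolding P_def using fin
    by (simp add: sum.cartesian_product case_prod_beta sum.inter_filter)
  also have "\<dots> = (\<Sum>e\<in>(\<lambda>p. {fst p, snd p}) ` P. \<Sum>p\<in>{p\<in>P. {fst p, snd p} = e}. \<sigma> (fst p) * \<sigma> (snd p))"
    using finP by (rule sum.image_gen)
  also have "\<dots> = (\<Sum>e\<in>(\<lambda>p. {fst p, snd p}) ` P. 2 * (\<Prod>w\<in>e. \<sigma> w))"
  proof (rule sum.cong)
    fix e assume "e \<in> (\<lambda>p. {fst p, snd p}) ` P"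
    then obtain u v where uv: "e = {u, v}" "u \<in> V" "v \<in> V" "E u v" unfolding P_def by auto
    \<comment> \<open>Without loops an edge comes from exactly two ordered pairs, and the product
      over the set \<open>{u, v}\<close> has two factors.\<close>
    have ne: "u \<noteq> v" using uv irr by auto
    have "{p\<in>P. {fst p, snd p} = e} = {(u, v), (v, u)}"
      unfolding P_def using uv sym by (auto simp: doubleton_eq_iff)
    then show "(\<Sum>p\<in>{p\<in>P. {fst p, snd p} = e}. \<sigma> (fst p) * \<sigma> (snd p)) = 2 * (\<Prod>w\<in>e. \<sigma> w)"
      using ne uv(1) by simp
  qed simp
  also have "\<dots> = 2 * edge_sum V E \<sigma>"
    unfolding img edge_sum_def sum_distrib_left ..
  finally show ?thesis by simp
qed

lemma ising_weight_eq_exp_energy: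
  assumes "simple_graph V E" "lam > 0"
  shows "ising_weight V E \<beta> lam \<sigma> = exp (energy (\<lambda>u v. if E u v then \<beta> / 2 else 0) V (\<lambda>_. ln lam) \<sigma>)"
proof -
  have "(\<Sum>u\<in>V. \<Sum>v\<in>V. (if E u v then \<beta> / 2 else 0) * \<sigma> u * \<sigma> v)
    = \<beta> / 2 * (\<Sum>u\<in>V. \<Sum>v\<in>V. if E u v then \<sigma> u * \<sigma> v else 0)"
    unfolding sum_distrib_left by (intro sum.cong refl) auto
  then show ?thesis
    using assms(2)
    unfolding ising_weight_def energy_def edge_sum_eq_double_sum[OF assms(1)] magnetization_def powr_def
    by (simp add: sum_distrib_left mult_ac flip: exp_add)
qed

section \<open>The largest fixed point of the tree recursion\<close>

text \<open>\<open>GREATEST\<close> says something only if a maximum exists. The set of fixed points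
  is closed by continuity, bounded above, and nonempty by the intermediate value theorem, so it
  contains its supremum.\<close>

lemma tree_Lstar_fixpoint:
  assumes "D \<ge> 1" "\<beta> \<ge> 0" "lam \<ge> 1"
  shows "tree_Lstar D \<beta> lam = ln lam + (real D - 1) * artanh (tanh (tree_Lstar D \<beta> lam) * tanh (\<beta> / 2))"
    and "tree_Lstar D \<beta> lam \<ge> 0"
proof -
  define \<Phi> where "\<Phi> L = ln lam + (real D - 1) * artanh (tanh L * tanh (\<beta> / 2))" for L
  define U where "U = ln lam + (real D - 1) * (\<beta> / 2)"
  have bd: "tanh L * tanh (\<beta> / 2) \<in> {-1<..<1}" for L
    using abs_tanh_mult_tanh_less_one[of L "\<beta> / 2"] by (auto simp: abs_less_iff)
  have cont: "continuous_on UNIV \<Phi>"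
    unfolding \<Phi>_def using bd by (intro continuous_intros) auto
  have ub: "\<Phi> L \<le> U" for L
  proof -
    \<comment> \<open>The edge factor never exceeds \<open>q\<close>, its limit at infinity; cleared
      of the denominator this is \<open>1 \<le> q * q\<close>.\<close>
    have "exp (2 * artanh (tanh L * tanh (\<beta> / 2))) \<le> exp (2 * (\<beta> / 2))"
    proof -
      define q where "q = exp (2 * (\<beta> / 2))"
      have "q \<ge> 1" unfolding q_def using assms by simp
      then have "1 * 1 \<le> q * q" by (intro mult_mono) auto
      moreover have "exp (2 * L) + q > 0" unfolding q_def by (simp add: add_pos_pos)
      ultimately show ?thesis
        unfolding exp_artanh_tanh_mult edge_factor_def q_def[symmetric]
        by (simp add: divide_le_eq algebra_simps)
    qed
    then have "artanh (tanh L * tanh (\<beta> / 2)) \<le> \<beta> / 2" by simp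
    then show ?thesis
      unfolding \<Phi>_def U_def using assms by (intro add_left_mono mult_left_mono) auto
  qed
  have U: "U \<ge> 0" unfolding U_def using assms by simp
  \<comment> \<open>At 0 the map equals \<open>ln lam\<close>, nonnegative because
    \<open>lam \<ge> 1\<close>; at \<open>U\<close> it is at most \<open>U\<close>. Hence a fixed
    point lies in between, and the largest one is nonnegative.\<close>
  have "\<exists>L\<ge>0. L \<le> U \<and> L - \<Phi> L = 0"
  proof (rule IVT')
    show "0 - \<Phi> 0 \<le> 0" unfolding \<Phi>_def using assms by simp
    show "0 \<le> U - \<Phi> U" using ub by simp
    show "continuous_on {0..U} (\<lambda>L. L - \<Phi> L)"
      using cont by (intro continuous_intros) (rule continuous_on_subset, auto)
  qed (rule U)
  then obtain L0 where L0: "L0 \<ge> 0" "L0 = \<Phi> L0" by auto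
  define A where "A = {L. L = \<Phi> L}"
  have "closed A" unfolding A_def by (rule closed_Collect_eq) (use cont in \<open>auto intro: continuous_intros\<close>)
  moreover have bdd: "bdd_above A" unfolding A_def using ub by (auto intro!: bdd_aboveI[of _ U]) metis
  moreover have "A \<noteq> {}" unfolding A_def using L0 by auto
  ultimately have mem: "Sup A \<in> A" by (intro closed_contains_Sup)
  have "tree_Lstar D \<beta> lam = Sup A"
    unfolding tree_Lstar_def \<Phi>_def[symmetric]
    by (rule Greatest_equality) (use mem bdd in \<open>auto simp: A_def intro: cSup_upper\<close>)
  then show "tree_Lstar D \<beta> lam = ln lam + (real D - 1) * artanh (tanh (tree_Lstar D \<beta> lam) * tanh (\<beta> / 2))"
    using mem unfolding A_def \<Phi>_def by simp
  have "L0 \<le> Sup A" using L0 bdd by (intro cSup_upper) (auto simp: A_def)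
  then show "tree_Lstar D \<beta> lam \<ge> 0"
    using L0 \<open>tree_Lstar D \<beta> lam = Sup A\<close> by simp
qed

section \<open>Comparison of the magnetizations\<close>

theorem theorem3:
  fixes V :: "'a set" and E :: "'a \<Rightarrow> 'a \<Rightarrow> bool" and D :: nat and \<beta> lam :: real
  assumes "D \<ge> 3"
    and "simple_graph V E"
    and "max_degree_le V E D"
    and "lam \<ge> 1"
    and "\<beta> \<ge> 0"
  shows "mean_mag V E \<beta> lam \<le> tree_mag_plus D \<beta> lam"
proof -
  define J where "J = (\<lambda>u v. if E u v then \<beta> / 2 else 0)"
  define L where "L = tree_Lstar D \<beta> lam"
  define x where "x = L + artanh (tanh L * tanh (\<beta> / 2))"
  define h where "h = (\<lambda>_ :: 'a. ln lam)"
  have fin: "finite V" using assms(2) unfolding simple_graph_def by simp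
  interpret ferromagnet J
    using assms(2,5) unfolding J_def simple_graph_def by unfold_locales auto
  have L: "L = ln lam + (real D - 1) * artanh (tanh L * tanh (\<beta> / 2))" and L0: "L \<ge> 0"
    unfolding L_def using tree_Lstar_fixpoint[of D \<beta> lam] assms by auto
  have x0: "x \<ge> 0"
  proof -
    have "exp (2 * artanh (tanh L * tanh (\<beta> / 2))) \<ge> 1"
      unfolding exp_artanh_tanh_mult using assms L0 by (intro edge_factor_ge_one) auto
    then show ?thesis unfolding x_def using L0 by simp
  qed
  \<comment> \<open>Twice the equation for \<open>L\<close>, exponentiated; \<open>D \<ge> 3\<close>
    keeps the natural number \<open>D - 1\<close> from being truncated.\<close>
  have fixp: "exp (2 * ln lam) * edge_factor (\<beta> / 2) (exp (2 * L)) ^ (D - 1) = exp (2 * L)"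
  proof -
    have "real (D - 1) = real D - 1" using assms(1) by simp
    then have "2 * ln lam + real (D - 1) * (2 * artanh (tanh L * tanh (\<beta> / 2))) = 2 * L"
      using L by (simp add: algebra_simps)
    then show ?thesis
      unfolding exp_artanh_tanh_mult[symmetric] exp_of_nat_mult[symmetric] exp_add[symmetric] by simp
  qed
  have ratio: "spin_ratio J V h v \<le> exp (2 * x)" if v: "v \<in> V" for v
  proof -
    have "spin_ratio J V h v \<le> exp (2 * L) * edge_factor (\<beta> / 2) (exp (2 * L))"
      unfolding h_def
    proof (rule spin_ratio_le_tree[OF fin _ _ _ _ _ fixp])
      have "card {u \<in> V. J v u \<noteq> 0} \<le> card {u \<in> V. E v u}" for v
        using fin by (intro card_mono) (auto simp: J_def)
      then show "card {u \<in> V. J v u \<noteq> 0} \<le> D" if "v \<in> V" for v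
        using assms(3) that order_trans unfolding max_degree_le_def by blast
    qed (use assms L0 v in \<open>auto simp: J_def\<close>)
    also have "\<dots> = exp (2 * x)"
      unfolding x_def exp_artanh_tanh_mult[symmetric] by (simp add: distrib_left flip: exp_add)
    finally show ?thesis .
  qed
  have w: "ising_weight V E \<beta> lam \<sigma> = exp (energy J V h \<sigma>)" for \<sigma>
    unfolding J_def h_def using assms by (intro ising_weight_eq_exp_energy) auto
  let ?Z = "partition_function J V h"
  have Z: "?Z > 0" using fin by (rule partition_function_pos)
  have "(\<Sum>\<sigma>\<in>configs V. magnetization V \<sigma> * ising_weight V E \<beta> lam \<sigma>)
    = (\<Sum>v\<in>V. \<Sum>\<sigma>\<in>configs V. \<sigma> v * exp (energy J V h \<sigma>))"
    unfolding magnetization_def w sum_distrib_right by (rule sum.swap)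
  also have "\<dots> \<le> (\<Sum>v\<in>V. tanh x * ?Z)"
    by (intro sum_mono sum_spin_le fin ratio)
  finally have "(\<Sum>\<sigma>\<in>configs V. magnetization V \<sigma> * ising_weight V E \<beta> lam \<sigma>) / ?Z \<le> tanh x * card V"
    using Z by (simp add: pos_divide_le_eq mult_ac)
  \<comment> \<open>For the empty graph, division by \<open>card V = 0\<close> gives 0, and
    \<open>x0\<close> provides \<open>tanh x \<ge> 0\<close>.\<close>
  then have "(\<Sum>\<sigma>\<in>configs V. magnetization V \<sigma> * ising_weight V E \<beta> lam \<sigma>) / ?Z / card V \<le> tanh x"
    using x0 fin by (cases "V = {}") (simp_all add: pos_divide_le_eq card_gt_0_iff del: divide_divide_eq_left)
  moreover have "(\<Sum>\<sigma>\<in>configs V. ising_weight V E \<beta> lam \<sigma>) = ?Z"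
    unfolding w partition_function_def ..
  moreover have "tree_mag_plus D \<beta> lam = tanh x"
    unfolding tree_mag_plus_def x_def L_def Let_def ..
  ultimately show ?thesis
    unfolding mean_mag_def by simp
qed

end
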